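(* Let $D(k)=\sum_{i=1}^{k} i!$ for $k=1,2,\ldots$, and define the sequence $\{u_n\}_{n=0,1,\ldots}$ by $u_n=1$ if $D(2k-1)\le n<D(2k)$ for some $k\in\{1,2,\ldots\}$, and $u_n=0$ otherwise. Then the lower and upper Ces\`aro limits $\underline{C},\overline{C}$ and the lower and upper Abel limits $\underline{A},\overline{A}$ of $\{u_n\}$ satisfy $$\underline{C}=\underline{A}=0\qquad\text{and}\qquad \overline{C}=\overline{A}=1;$$ in particular $\underline{C}=\underline{A}<\overline{A}=\overline{C}$.
   Context: For a real sequence $\{u_n\}_{n=0,1,\ldots}$, the lower and upper Ces\`aro limits are $$\underline{C}=\liminf_{n\to\infty}\frac1n\sum_{i=0}^{n-1}u_i,\qquad \overline{C}=\limsup_{n\to\infty}\frac1n\sum_{i=0}^{n-1}u_i,$$ and the lower and upper Abel limits are $$\underline{A}=\liminf_{\alpha\to1-}(1-\alpha)\sum_{n=0}^\infty u_n\alpha^n,\qquad \overline{A}=\limsup_{\alpha\to1-}(1-\alpha)\sum_{n=0}^\infty u_n\alpha^n,$$ where $\alpha\to 1-$ means $\alpha\in[0,1)$ tends to $1$ from below. *)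

theory Defs
  imports "HOL-Analysis.Analysis"
begin

text \<open>
  Limits are taken in the extended reals, since for a general real sequence they may be infinite.
\<close>

definition lower_cesaro :: "(nat \<Rightarrow> real) \<Rightarrow> ereal" where
  "lower_cesaro u = liminf (\<lambda>n. ereal (1 / real n * (\<Sum>i<n. u i)))"

definition upper_cesaro :: "(nat \<Rightarrow> real) \<Rightarrow> ereal" where
  "upper_cesaro u = limsup (\<lambda>n. ereal (1 / real n * (\<Sum>i<n. u i)))"

text \<open>
  The Abel limits are meaningful only if the power series of \<open>u\<close> converges on \<open>[0, 1)\<close>, which is
  always the case for bounded \<open>u\<close>; otherwise the value of the infinite sum is unspecified.
\<close>

definition lower_abel :: "(nat \<Rightarrow> real) \<Rightarrow> ereal" where
  "lower_abel u = Liminf (at 1 within {0..<1}) (\<lambda>\<alpha>. ereal ((1 - \<alpha>) * (\<Sum>n. u n * \<alpha> ^ n)))"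

definition upper_abel :: "(nat \<Rightarrow> real) \<Rightarrow> ereal" where
  "upper_abel u = Limsup (at 1 within {0..<1}) (\<lambda>\<alpha>. ereal ((1 - \<alpha>) * (\<Sum>n. u n * \<alpha> ^ n)))"

definition fact_sum :: "nat \<Rightarrow> nat" where
  "fact_sum k = (\<Sum>i=1..k. fact i)"

definition block_seq :: "nat \<Rightarrow> real" where
  "block_seq n = (if \<exists>k\<ge>1. fact_sum (2 * k - 1) \<le> n \<and> n < fact_sum (2 * k) then 1 else 0)"

end

theory Submission
  imports Defs
begin

text \<open>
  The ratio of consecutive values of \<open>D\<close> tends to \<open>0\<close>, so along the right ends of the blocks
  the averages are dominated by the last block, on which the sequence is constantly \<open>0\<close> or \<open>1\<close>.
  For the Abel means of a block \<open>[a, b)\<close> with \<open>a / b\<close> small take \<open>\<alpha> = exp (- 1 / sqrt (a b))\<close>: then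
  \<open>\<alpha>\<^sup>a\<close> is close to \<open>1\<close> and \<open>\<alpha>\<^sup>b\<close> is close to \<open>0\<close>, so the geometric weights concentrate on the block.
\<close>

section \<open>Lower and upper limits attained along a sequence\<close>

text \<open>Any property that holds eventually in \<open>F\<close> holds at \<open>s k\<close> for
  large \<open>k\<close>, so the infimum over it is at most \<open>f (s k)\<close> and hence at most
  the limit \<open>c\<close>. The filter is left general to serve both n \<rightarrow> \<infinity>
  and the one-sided limit at 1.\<close>

lemma Liminf_eq_if_attained:
  fixes f :: "'a \<Rightarrow> real"
  assumes "eventually (\<lambda>x. c \<le> f x) F" "filterlim s F sequentially" "(\<lambda>k. f (s k)) \<longlonglongrightarrow> c"
  shows "Liminf F (\<lambda>x. ereal (f x)) = ereal c"
proof (rule antisym)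
  show "Liminf F (\<lambda>x. ereal (f x)) \<le> ereal c"
  proof (rule Liminf_least)
    fix P
    assume "eventually P F"
    then have "\<forall>\<^sub>F k in sequentially. P (s k)"
      using assms(2) by (rule eventually_compose_filterlim)
    then have "\<forall>\<^sub>F k in sequentially. (INF x\<in>Collect P. ereal (f x)) \<le> ereal (f (s k))"
      by (rule eventually_mono) (auto intro: INF_lower)
    then show "(INF x\<in>Collect P. ereal (f x)) \<le> ereal c"
      using assms(3) by (intro tendsto_lowerbound[of "\<lambda>k. ereal (f (s k))"]) auto
  qed
  show "ereal c \<le> Liminf F (\<lambda>x. ereal (f x))"
    using assms(1) by (intro Liminf_bounded) simp
qed

lemma Limsup_eq_if_attained:
  fixes f :: "'a \<Rightarrow> real"
  assumes "eventually (\<lambda>x. f x \<le> c) F" "filterlim s F sequentially" "(\<lambda>k. f (s k)) \<longlonglongrightarrow> c"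
  shows "Limsup F (\<lambda>x. ereal (f x)) = ereal c"
proof -
  have "Liminf F (\<lambda>x. ereal (- f x)) = ereal (- c)"
    using assms by (intro Liminf_eq_if_attained[of _ _ _ s]) (auto intro: tendsto_minus)
  then have "- Limsup F (\<lambda>x. ereal (f x)) = - ereal c"
    by (simp flip: ereal_Liminf_uminus)
  then show ?thesis
    using ereal_uminus_eq_iff by blast
qed

section \<open>Error of a mean over one constant block\<close>

text \<open>After subtracting \<open>c\<close> only the first \<open>a\<close> terms survive, each
  of absolute value at most 1.\<close>

lemma cesaro_mean_constant_block:
  fixes u :: "nat \<Rightarrow> real"
  assumes u: "\<And>n. u n \<in> {0..1}" and c: "c \<in> {0..1}"
    and block: "\<And>n. a \<le> n \<Longrightarrow> n < b \<Longrightarrow> u n = c" and ab: "a \<le> b" "0 < b"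
  shows "\<bar>1 / real b * (\<Sum>i<b. u i) - c\<bar> \<le> real a / real b"
proof -
  have "1 / real b * (\<Sum>i<b. u i) - c = (\<Sum>i<b. u i - c) / real b"
    using ab by (simp add: sum_subtractf field_simps)
  also have "(\<Sum>i<b. u i - c) = (\<Sum>i<a. u i - c)"
    using ab block by (intro sum.mono_neutral_right) auto
  finally have eq: "1 / real b * (\<Sum>i<b. u i) - c = (\<Sum>i<a. u i - c) / real b" .
  have "\<bar>u i - c\<bar> \<le> 1" for i
    using u[of i] c by auto
  then have "\<bar>\<Sum>i<a. u i - c\<bar> \<le> (\<Sum>i<a. 1::real)"
    by (intro order_trans[OF sum_abs] sum_mono) auto
  then show ?thesis
    unfolding eq by (simp add: abs_divide divide_right_mono)
qed

lemma summable_bounded_power_series: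
  fixes u :: "nat \<Rightarrow> real"
  assumes "\<And>n. \<bar>u n\<bar> \<le> 1" "0 \<le> x" "x < 1"
  shows "summable (\<lambda>n. u n * x ^ n)"
  using assms
  by (intro summable_comparison_test'[OF summable_geometric[of x]])
     (auto simp: abs_mult mult_left_le_one_le)

text \<open>The weights \<open>(1 - x) * x ^ n\<close> have total mass 1, of which the block carries
  \<open>x ^ a - x ^ b\<close>. The deviation from \<open>c\<close> vanishes on the block and is at
  most 1 elsewhere, so the error is at most the mass outside.\<close>

lemma abel_mean_constant_block:
  fixes u :: "nat \<Rightarrow> real"
  assumes u: "\<And>n. u n \<in> {0..1}" and c: "c \<in> {0..1}"
    and block: "\<And>n. a \<le> n \<Longrightarrow> n < b \<Longrightarrow> u n = c" and ab: "a \<le> b"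
    and x: "0 \<le> x" "x < 1"
  shows "\<bar>(1 - x) * (\<Sum>n. u n * x ^ n) - c\<bar> \<le> 1 - x ^ a + x ^ b"
proof -
  \<comment> \<open>The geometric series restricted to the block; \<open>x ^ n - ?g n\<close> is
    then a summable majorant of the deviation that vanishes on the block.\<close>
  let ?g = "\<lambda>n. if n \<in> {a..<b} then x ^ n else 0"
  have bd: "\<bar>u n - c\<bar> \<le> 1" for n
    using u[of n] c by auto
  have su: "summable (\<lambda>n. u n * x ^ n)"
    using u x by (intro summable_bounded_power_series) auto
  have geo: "(\<lambda>n. x ^ n) sums (1 / (1 - x))"
    using x by (intro geometric_sums) auto
  have g: "?g sums (\<Sum>n\<in>{a..<b}. x ^ n)"
    by (rule sums_If_finite_set) simp
  have tel: "(1 - x) * (\<Sum>n\<in>{a..<b}. x ^ n) = x ^ a - x ^ b"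
    using ab
  proof (induction b rule: dec_induct)
    case (step n)
    then show ?case by (simp add: distrib_left) (simp add: left_diff_distrib)
  qed simp
  have "(\<lambda>n. u n * x ^ n - c * x ^ n) sums ((\<Sum>n. u n * x ^ n) - c * (1 / (1 - x)))"
    by (intro sums_diff summable_sums su sums_mult geo)
  moreover have "(\<lambda>n. x ^ n - ?g n) sums (1 / (1 - x) - (\<Sum>n\<in>{a..<b}. x ^ n))"
    by (intro sums_diff geo g)
  moreover have "norm (u n * x ^ n - c * x ^ n) \<le> x ^ n - ?g n" for n
  proof (cases "n \<in> {a..<b}")
    case False
    then show ?thesis
      using bd[of n] x
      by (auto simp: abs_mult mult_left_le_one_le simp flip: left_diff_distrib)
  qed (simp add: block)
  ultimately have "\<bar>(\<Sum>n. u n * x ^ n) - c * (1 / (1 - x))\<bar>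
      \<le> 1 / (1 - x) - (\<Sum>n\<in>{a..<b}. x ^ n)"
    unfolding real_norm_def[symmetric] by (rule norm_sums_le)
  then have "(1 - x) * \<bar>(\<Sum>n. u n * x ^ n) - c * (1 / (1 - x))\<bar>
      \<le> (1 - x) * (1 / (1 - x) - (\<Sum>n\<in>{a..<b}. x ^ n))"
    using x by (intro mult_left_mono) auto
  \<comment> \<open>The positive factor \<open>1 - x\<close> moves inside the absolute value and
    cancels the denominator.\<close>
  moreover have "(1 - x) * \<bar>(\<Sum>n. u n * x ^ n) - c * (1 / (1 - x))\<bar>
      = \<bar>(1 - x) * (\<Sum>n. u n * x ^ n) - c\<bar>"
  proof -
    have "(1 - x) * \<bar>(\<Sum>n. u n * x ^ n) - c * (1 / (1 - x))\<bar>
      = \<bar>(1 - x) * ((\<Sum>n. u n * x ^ n) - c * (1 / (1 - x)))\<bar>"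
      using x by (simp add: abs_mult)
    also have "(1 - x) * ((\<Sum>n. u n * x ^ n) - c * (1 / (1 - x))) = (1 - x) * (\<Sum>n. u n * x ^ n) - c"
      using x by (simp add: field_simps)
    finally show ?thesis .
  qed
  moreover have "(1 - x) * (1 / (1 - x) - (\<Sum>n\<in>{a..<b}. x ^ n)) = 1 - (x ^ a - x ^ b)"
    using x by (simp add: right_diff_distrib flip: tel)
  ultimately show ?thesis
    by simp
qed

section \<open>Convergence of the means along a sequence of blocks\<close>

lemma cesaro_limit_along_blocks:
  fixes u :: "nat \<Rightarrow> real" and a b :: "nat \<Rightarrow> nat"
  assumes u: "\<And>n. u n \<in> {0..1}" and c: "c \<in> {0..1}"
    and block: "\<And>k n. a k \<le> n \<Longrightarrow> n < b k \<Longrightarrow> u n = c"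
    and ab: "\<And>k. 0 < a k" "\<And>k. a k \<le> b k"
    and ratio: "(\<lambda>k. real (a k) / real (b k)) \<longlonglongrightarrow> 0"
  shows "(\<lambda>k. 1 / real (b k) * (\<Sum>i<b k. u i)) \<longlonglongrightarrow> c"
proof (rule LIM_zero_cancel, rule Lim_null_comparison[OF _ ratio], rule always_eventually, rule allI)
  fix k
  show "norm (1 / real (b k) * (\<Sum>i<b k. u i) - c) \<le> real (a k) / real (b k)"
    unfolding real_norm_def
    using ab[of k] by (intro cesaro_mean_constant_block u c block) auto
qed

lemma abel_limit_along_blocks:
  fixes u :: "nat \<Rightarrow> real" and a b :: "nat \<Rightarrow> nat"
  assumes u: "\<And>n. u n \<in> {0..1}" and c: "c \<in> {0..1}"
    and block: "\<And>k n. a k \<le> n \<Longrightarrow> n < b k \<Longrightarrow> u n = c"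
    and ab: "\<And>k. 0 < a k" "\<And>k. a k \<le> b k"
    and ratio: "(\<lambda>k. real (a k) / real (b k)) \<longlonglongrightarrow> 0"
  obtains s where "filterlim s (at 1 within {0..<1}) sequentially"
    and "(\<lambda>k. (1 - s k) * (\<Sum>n. u n * s k ^ n)) \<longlonglongrightarrow> c"
proof
  \<comment> \<open>Here \<open>r k / a k\<close> equals 1 / sqrt(a b) at index \<open>k\<close>.
    Written this way, the powers of \<open>s k\<close> with exponents \<open>a k\<close> and
    \<open>b k\<close> depend on \<open>r k\<close> alone.\<close>
  define r where "r k = sqrt (real (a k) / real (b k))" for k
  define s where "s k = exp (- (r k / real (a k)))" for k
  have b0: "0 < b k" for k
    using ab[of k] by simp
  have r_pos: "0 < r k" for k
    using ab b0 by (simp add: r_def)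
  have r: "r \<longlonglongrightarrow> 0"
    using tendsto_real_sqrt[OF ratio] unfolding r_def by simp
  have s01: "0 < s k" "s k < 1" for k
    using r_pos[of k] ab by (auto simp: s_def)
  have sa: "s k ^ a k = exp (- r k)" for k
    using ab[of k] by (simp add: s_def flip: exp_of_nat_mult)
  have sb: "s k ^ b k = exp (- inverse (r k))" for k
  proof -
    have "r k * r k = real (a k) / real (b k)"
      by (simp add: r_def)
    then have "real (b k) * (r k / real (a k)) = inverse (r k)"
      using ab(1)[of k] b0[of k] r_pos[of k] by (simp add: field_simps)
    then show ?thesis
      by (simp add: s_def flip: exp_of_nat_mult)
  qed
  \<comment> \<open>Since \<open>a k\<close> is at least 1, the exponent is squeezed between 0 and
    \<open>r k\<close>; hence \<open>s\<close> tends to 1.\<close>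
  have "(\<lambda>k. r k / real (a k)) \<longlonglongrightarrow> 0"
  proof (rule tendsto_sandwich[OF _ _ tendsto_const r])
    show "\<forall>\<^sub>F k in sequentially. 0 \<le> r k / real (a k)"
      using r_pos by (simp add: less_imp_le)
    have "r k / real (a k) \<le> r k" for k
      using r_pos[of k] ab(1)[of k] by (simp add: divide_le_eq)
    then show "\<forall>\<^sub>F k in sequentially. r k / real (a k) \<le> r k"
      by simp
  qed
  then have "s \<longlonglongrightarrow> exp (- 0)"
    unfolding s_def by (intro tendsto_intros)
  then show "filterlim s (at 1 within {0..<1}) sequentially"
    using s01 by (auto simp: filterlim_at less_imp_le intro!: always_eventually)
       (metis less_irrefl)
  have "filterlim (\<lambda>k. inverse (r k)) at_top sequentially"
    using r r_pos by (intro filterlim_inverse_at_top) auto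
  then have "(\<lambda>k. exp (- inverse (r k))) \<longlonglongrightarrow> 0"
    by (intro filterlim_compose[OF exp_at_bot]) (simp add: filterlim_uminus_at_bot)
  moreover have "(\<lambda>k. 1 - exp (- r k)) \<longlonglongrightarrow> 1 - exp (- 0)"
    by (intro tendsto_intros r)
  ultimately have bound: "(\<lambda>k. 1 - s k ^ a k + s k ^ b k) \<longlonglongrightarrow> 0"
    unfolding sa sb using tendsto_add_zero by fastforce
  show "(\<lambda>k. (1 - s k) * (\<Sum>n. u n * s k ^ n)) \<longlonglongrightarrow> c"
  proof (rule LIM_zero_cancel, rule Lim_null_comparison[OF _ bound], rule always_eventually, rule allI)
    fix k
    show "norm ((1 - s k) * (\<Sum>n. u n * s k ^ n) - c) \<le> 1 - s k ^ a k + s k ^ b k"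
      unfolding real_norm_def
      using ab(2)[of k] s01[of k] by (intro abel_mean_constant_block u c block) auto
  qed
qed

lemma cesaro_mean_bounds:
  fixes u :: "nat \<Rightarrow> real"
  assumes "\<And>n. u n \<in> {0..1}"
  shows "1 / real n * (\<Sum>i<n. u i) \<in> {0..1}"
proof -
  have "0 \<le> (\<Sum>i<n. u i)" "(\<Sum>i<n. u i) \<le> (\<Sum>i<n. 1)"
    using assms by (auto intro!: sum_nonneg simp del: sum_constant intro: sum_mono)
  \<comment> \<open>For \<open>n = 0\<close> division by zero yields 0, which still lies in the
    interval.\<close>
  then show ?thesis
    by (cases "n = 0") (auto simp: divide_le_eq)
qed

lemma abel_mean_bounds:
  fixes u :: "nat \<Rightarrow> real"
  assumes u: "\<And>n. u n \<in> {0..1}" and x: "0 \<le> x" "x < 1"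
  shows "(1 - x) * (\<Sum>n. u n * x ^ n) \<in> {0..1}"
proof -
  have su: "summable (\<lambda>n. u n * x ^ n)"
    using u x by (intro summable_bounded_power_series) auto
  have "0 \<le> (\<Sum>n. u n * x ^ n)"
    using u x by (intro suminf_nonneg su) auto
  moreover have "(\<Sum>n. u n * x ^ n) \<le> (\<Sum>n. x ^ n)"
    using u x by (intro suminf_le su summable_geometric) (auto simp: mult_left_le_one_le)
  then have "(\<Sum>n. u n * x ^ n) \<le> 1 / (1 - x)"
    using x by (simp add: suminf_geometric)
  ultimately show ?thesis
    using x by (simp add: pos_le_divide_eq mult.commute)
qed

section \<open>Extreme limits of a sequence with long constant blocks\<close>

context
  fixes u :: "nat \<Rightarrow> real" and a b :: "nat \<Rightarrow> nat"
  assumes u: "\<And>n. u n \<in> {0..1}"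
    and ab: "\<And>k. 0 < a k" "\<And>k. a k \<le> b k"
    and b_at_top: "filterlim b at_top sequentially"
    and ratio: "(\<lambda>k. real (a k) / real (b k)) \<longlonglongrightarrow> 0"
begin

text \<open>All means lie in [0, 1], so 0 is a lower bound; the blocks of zeros supply sequences
  along which the means tend to it.\<close>

lemma lower_limits_eq_0:
  assumes "\<And>k n. a k \<le> n \<Longrightarrow> n < b k \<Longrightarrow> u n = 0"
  shows "lower_cesaro u = 0" and "lower_abel u = 0"
proof -
  show "lower_cesaro u = 0"
    unfolding lower_cesaro_def zero_ereal_def
    using cesaro_mean_bounds[OF u]
    by (intro Liminf_eq_if_attained[OF _ b_at_top] cesaro_limit_along_blocks[OF u _ assms ab ratio]) auto
  obtain s where "filterlim s (at 1 within {0..<1}) sequentially"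
    and "(\<lambda>k. (1 - s k) * (\<Sum>n. u n * s k ^ n)) \<longlonglongrightarrow> 0"
    by (rule abel_limit_along_blocks[OF u _ assms ab ratio]) auto
  then show "lower_abel u = 0"
    unfolding lower_abel_def zero_ereal_def
    using abel_mean_bounds[OF u]
    by (intro Liminf_eq_if_attained) (auto simp: eventually_at_filter)
qed

lemma upper_limits_eq_1:
  assumes "\<And>k n. a k \<le> n \<Longrightarrow> n < b k \<Longrightarrow> u n = 1"
  shows "upper_cesaro u = 1" and "upper_abel u = 1"
proof -
  show "upper_cesaro u = 1"
    unfolding upper_cesaro_def one_ereal_def
    using cesaro_mean_bounds[OF u]
    by (intro Limsup_eq_if_attained[OF _ b_at_top] cesaro_limit_along_blocks[OF u _ assms ab ratio]) auto
  obtain s where "filterlim s (at 1 within {0..<1}) sequentially"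
    and "(\<lambda>k. (1 - s k) * (\<Sum>n. u n * s k ^ n)) \<longlonglongrightarrow> 1"
    by (rule abel_limit_along_blocks[OF u _ assms ab ratio]) auto
  then show "upper_abel u = 1"
    unfolding upper_abel_def one_ereal_def
    using abel_mean_bounds[OF u]
    by (intro Limsup_eq_if_attained) (auto simp: eventually_at_filter)
qed

end

section \<open>Growth of the factorial sums\<close>

lemma fact_sum_Suc: "fact_sum (Suc m) = fact_sum m + fact (Suc m)"
  by (simp add: fact_sum_def)

lemma fact_sum_mono: "m \<le> n \<Longrightarrow> fact_sum m \<le> fact_sum n"
  by (rule lift_Suc_mono_le) (auto simp: fact_sum_Suc)

lemma fact_sum_ge: "m \<le> fact_sum m"
proof (induction m)
  case (Suc m)
  then show ?case
    using fact_ge_1[of "Suc m", where 'a = nat] unfolding fact_sum_Suc by linarith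
qed simp

text \<open>The last factorial dominates: inductively the earlier ones sum to at most 2 m!, which is
  at most (m + 1)! once m \<ge> 1.\<close>

lemma fact_sum_le: "fact_sum m \<le> 2 * fact m"
proof (induction m)
  case (Suc m)
  show ?case
  proof (cases "m = 0")
    case False
    then have "2 * fact m \<le> (Suc m * fact m :: nat)"
      by (intro mult_right_mono) auto
    then have "2 * fact m \<le> (fact (Suc m) :: nat)"
      by simp
    then show ?thesis
      using Suc unfolding fact_sum_Suc by linarith
  qed (simp add: fact_sum_def)
qed (simp add: fact_sum_def)

text \<open>The quotient is at most 2 m! / (m + 1)! = 2 / (m + 1).\<close>

lemma fact_sum_ratio: "(\<lambda>m. real (fact_sum m) / real (fact_sum (Suc m))) \<longlonglongrightarrow> 0"
proof (rule tendsto_sandwich[OF _ _ tendsto_const])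
  have "real (fact_sum m) / real (fact_sum (Suc m)) \<le> 2 / real (Suc m)" for m
  proof -
    have "real (fact_sum m) \<le> 2 * fact m"
      using of_nat_mono[OF fact_sum_le[of m], where 'a = real] by simp
    moreover have "fact (Suc m) \<le> real (fact_sum (Suc m))"
      by (simp only: fact_sum_Suc of_nat_add of_nat_fact)
    ultimately have "real (fact_sum m) / real (fact_sum (Suc m)) \<le> 2 * fact m / fact (Suc m)"
      by (intro frac_le) auto
    also have "\<dots> = 2 / real (Suc m)"
      by (simp add: divide_simps del: of_nat_Suc)
    finally show ?thesis .
  qed
  then show "\<forall>\<^sub>F m in sequentially. real (fact_sum m) / real (fact_sum (Suc m)) \<le> 2 / real (Suc m)"
    by simp
  show "(\<lambda>m. 2 / real (Suc m)) \<longlonglongrightarrow> 0"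
    using lim_const_over_n[of "2 :: real"] by (rule LIMSEQ_Suc)
qed simp

lemma fact_sum_at_top: "filterlim fact_sum at_top sequentially"
  by (rule filterlim_at_top_mono[OF filterlim_ident]) (simp add: fact_sum_ge)

section \<open>The blocks of the concrete sequence\<close>

lemma block_seq_eq_1:
  assumes "fact_sum (2 * k + 1) \<le> n" "n < fact_sum (2 * k + 2)"
  shows "block_seq n = 1"
  \<comment> \<open>Blocks are numbered from 0 here but from 1 in the definition, hence the witness
    \<open>Suc k\<close>.\<close>
  using assms unfolding block_seq_def by (auto intro!: exI[of _ "Suc k"])

text \<open>By monotonicity of \<open>fact_sum\<close>, a block of ones with index
  \<open>j \<le> k\<close> ends no later than \<open>fact_sum (2 * k)\<close>, and one with
  \<open>j > k\<close> starts no earlier than \<open>fact_sum (2 * k + 1)\<close>.\<close>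

lemma block_seq_eq_0:
  assumes n: "fact_sum (2 * k) \<le> n" "n < fact_sum (2 * k + 1)"
  shows "block_seq n = 0"
proof -
  have False if "fact_sum (2 * j - 1) \<le> n" "n < fact_sum (2 * j)" for j
  proof (cases "j \<le> k")
    case True
    then show False
      using fact_sum_mono[of "2 * j" "2 * k"] n that by simp
  next
    case False
    then have "2 * k + 1 \<le> 2 * j - 1"
      by linarith
    then show False
      using fact_sum_mono[of "2 * k + 1" "2 * j - 1"] n that by linarith
  qed
  then show ?thesis
    unfolding block_seq_def by auto
qed

theorem proposition1:
  shows "lower_cesaro block_seq = 0 \<and> lower_abel block_seq = 0 \<and>
    upper_cesaro block_seq = 1 \<and> upper_abel block_seq = 1 \<and>
    lower_cesaro block_seq = lower_abel block_seq \<and>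
    lower_abel block_seq < upper_abel block_seq \<and>
    upper_abel block_seq = upper_cesaro block_seq"
proof -
  have u: "block_seq n \<in> {0..1}" for n
    by (simp add: block_seq_def)
  have pos: "0 < fact_sum (Suc m)" for m
    using fact_sum_ge[of "Suc m"] by simp
  have mono: "fact_sum m \<le> fact_sum (Suc m)" for m
    by (simp add: fact_sum_mono)
  \<comment> \<open>The offset \<open>i\<close> selects the parity of the block, so both kinds share
    the limits below.\<close>
  have sub: "filterlim (\<lambda>k::nat. 2 * k + i) at_top sequentially" for i
    by (rule filterlim_at_top_mono[OF filterlim_ident]) simp
  have at_top: "filterlim (\<lambda>k. fact_sum (Suc (2 * k + i))) at_top sequentially" for i
    by (intro filterlim_compose[OF fact_sum_at_top] filterlim_compose[OF filterlim_Suc] sub)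
  have ratio: "(\<lambda>k. real (fact_sum (2 * k + i)) / real (fact_sum (Suc (2 * k + i)))) \<longlonglongrightarrow> 0" for i
    by (rule filterlim_compose[OF fact_sum_ratio sub])
  \<comment> \<open>Offset 2 instead of 0: the first zero block starts at
    \<open>fact_sum 0 = 0\<close>, whereas left ends must be positive.\<close>
  have "lower_cesaro block_seq = 0" "lower_abel block_seq = 0"
    using lower_limits_eq_0[OF u _ mono at_top[of 2] ratio[of 2]]
      block_seq_eq_0[of "Suc _"] pos by auto
  \<comment> \<open>Offset 1 gives the blocks of ones, from \<open>fact_sum (2 * k + 1)\<close> up
    to \<open>fact_sum (2 * k + 2)\<close>.\<close>
  moreover have "upper_cesaro block_seq = 1" "upper_abel block_seq = 1"
    using upper_limits_eq_1[OF u _ mono at_top[of 1] ratio[of 1]]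
      block_seq_eq_1 pos by auto
  ultimately show ?thesis
    by simp
qed

end
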